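(* Let $N=2K+1$, let $\boldsymbol{y}=\{y_n\}_{n=1}^{N}$ be a real input sequence, and let $\boldsymbol{\alpha}=\{\alpha_k\}_{k=-K}^{K}$ and $\boldsymbol{\beta}=\{\beta_k\}_{k=-K}^{K}$ be nonnegative real weights, with $A=\sum_{k=-K}^{K}\alpha_k>0$ and $B=\sum_{k=-K}^{K}\beta_k$. Consider the objective $$G(\boldsymbol{x},\boldsymbol{y},\boldsymbol{\alpha},\boldsymbol{\beta})=\sum_{n=1}^{N}\sum_{k=-K}^{K}\alpha_k(y_{n+k}-x_n)^2+\sum_{n=1}^{N}\sum_{k=-K}^{K}\beta_k(x_{n+k}-x_n)^2 .$$ Then the minimizer $\boldsymbol{x_*}$ of $G$ over $\boldsymbol{x}=\{x_n\}_{n=1}^{N}\in\mathbb{R}^N$ is $$\boldsymbol{x_*}=\mathcal{F}^{-1}\left(\mathcal{F}(\boldsymbol{y})\otimes\mathcal{F}(\boldsymbol{p})\oslash\mathcal{F}(\boldsymbol{v})\right),$$ where, for $k\in\{-K,\ldots,K\}$, $$p_k=\frac{1}{A}\alpha_k,\qquad v_k=\begin{cases}\frac{A+2B}{A},& k=0,\\ -\frac{2\beta_k}{A},& k\neq 0.\end{cases}$$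
   Context: All indices are cyclic modulo $N=2K+1$: $y_{n+N}=y_n$, $x_{n+N}=x_n$, and a window indexed by $k\in\{-K,\ldots,K\}$ is regarded as a sequence on $\mathbb{Z}/N\mathbb{Z}$. $\mathcal{F}$ is the discrete Fourier transform of length $N$, $(\mathcal{F}(\boldsymbol{a}))_n=\sum_{k}a_k e^{-j2\pi kn/N}$ with $j$ the imaginary unit and $k$ running over the residues modulo $N$, and $\mathcal{F}^{-1}$ is its inverse. $\otimes$ and $\oslash$ denote element-wise (Hadamard) multiplication and division. Convention: because of the summation over $n$, the second sum in $G$ is unchanged when $\beta_k$ and $\beta_{-k}$ are both replaced by their average, so the weights $\boldsymbol{\beta}$ are taken, without loss of generality, to be in symmetric form, $\beta_k=\beta_{-k}$.
   Formalization: The formula as stated fails if α is not symmetric or β_0≠0 (e.g. K=0, α_0=β_0=1 gives y/3, not y). It is proved verbatim for α_{-k}=α_k and β_0=0, and for all weights with p_k=α_{-k}/A and β_0 replaced by 0 in v. *)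

theory Defs
  imports "HOL-Analysis.Analysis"
begin

text \<open>
  Everything lives on the residues modulo \<open>N = 2 * K + 1\<close>. A vector in \<open>\<real>\<^sup>N\<close> is represented by its
  \<open>N\<close>-periodic extension to the integers. For the windows \<open>\<alpha>\<close>, \<open>\<beta>\<close>, \<open>p\<close>, \<open>v\<close> only the values on
  \<open>{- K..K}\<close>, a complete system of residues, are ever used, so they need not be periodic.
\<close>

definition cyclic :: "nat \<Rightarrow> (int \<Rightarrow> 'a) \<Rightarrow> bool" where
  "cyclic N a \<longleftrightarrow> (\<forall>n. a (n + int N) = a n)"

definition window :: "nat \<Rightarrow> int set" where
  "window K = {- int K..int K}"

definition G :: "nat \<Rightarrow> (int \<Rightarrow> real) \<Rightarrow> (int \<Rightarrow> real) \<Rightarrow> (int \<Rightarrow> real) \<Rightarrow> (int \<Rightarrow> real) \<Rightarrow> real" where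
  "G K x y \<alpha> \<beta> =
     (\<Sum>n\<in>{1..int (2 * K + 1)}. \<Sum>k\<in>window K. \<alpha> k * (y (n + k) - x n)\<^sup>2)
   + (\<Sum>n\<in>{1..int (2 * K + 1)}. \<Sum>k\<in>window K. \<beta> k * (x (n + k) - x n)\<^sup>2)"

definition dft :: "nat \<Rightarrow> (int \<Rightarrow> complex) \<Rightarrow> int \<Rightarrow> complex" where
  "dft K a n = (\<Sum>k\<in>window K. a k *
     exp (- (\<i> * of_real (2 * pi * of_int k * of_int n / real (2 * K + 1)))))"

definition idft :: "nat \<Rightarrow> (int \<Rightarrow> complex) \<Rightarrow> int \<Rightarrow> complex" where
  "idft K b k = (\<Sum>n\<in>window K. b n *
     exp (\<i> * of_real (2 * pi * of_int k * of_int n / real (2 * K + 1)))) / of_nat (2 * K + 1)"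

definition p_weights :: "nat \<Rightarrow> (int \<Rightarrow> real) \<Rightarrow> int \<Rightarrow> real" where
  "p_weights K \<alpha> k = (let A = \<Sum>i\<in>window K. \<alpha> i in 1 / A * \<alpha> k)"

definition v_weights :: "nat \<Rightarrow> (int \<Rightarrow> real) \<Rightarrow> (int \<Rightarrow> real) \<Rightarrow> int \<Rightarrow> real" where
  "v_weights K \<alpha> \<beta> k =
     (let A = \<Sum>i\<in>window K. \<alpha> i; B = \<Sum>i\<in>window K. \<beta> i
      in if k = 0 then (A + 2 * B) / A else - (2 * \<beta> k / A))"

text \<open>
  A product of transforms is a cyclic convolution, \<open>\<Sum>k. p k * y (n - k)\<close>, while \<open>G\<close> pairs
  \<open>\<alpha> k\<close> with \<open>y (n + k)\<close>; and \<open>\<beta> 0\<close> enters \<open>v 0\<close> through \<open>B\<close> but does not enter \<open>G\<close>.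
  So the expression below, evaluated at \<open>\<alpha>\<close> and \<open>\<beta>\<close>, is the minimizer of \<open>G\<close> when \<open>\<alpha>\<close> is
  symmetric and \<open>\<beta> 0 = 0\<close>; in general \<open>\<alpha>\<close> must be reflected and \<open>\<beta> 0\<close> replaced by \<open>0\<close>.
\<close>

definition fourier_solution ::
  "nat \<Rightarrow> (int \<Rightarrow> real) \<Rightarrow> (int \<Rightarrow> real) \<Rightarrow> (int \<Rightarrow> real) \<Rightarrow> int \<Rightarrow> complex" where
  "fourier_solution K y \<alpha> \<beta> =
     idft K (\<lambda>n. dft K (\<lambda>k. of_real (y k)) n * dft K (\<lambda>k. of_real (p_weights K \<alpha> k)) n
                / dft K (\<lambda>k. of_real (v_weights K \<alpha> \<beta> k)) n)"

lemma window_sum_roots_of_unity: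
  fixes d :: int
  shows "(\<Sum>n\<in>window K. exp (\<i> * of_real (2 * pi * of_int d * of_int n / real (2 * K + 1))))
       = (if int (2 * K + 1) dvd d then of_nat (2 * K + 1) else 0)" (is "?S = _")
proof -
  define N where "N = 2 * K + 1"
  define e where "e n = exp (\<i> * of_real (2 * pi * of_int d * of_int n / real N))" for n :: int
  have N: "N > 0" by (simp add: N_def)
  have S: "?S = (\<Sum>n\<in>window K. e n)" by (simp add: e_def N_def)
  have e_add: "e (m + n) = e m * e n" for m n
    by (simp add: e_def exp_add [symmetric] add_divide_distrib algebra_simps)
  have e_N: "e (int N) = 1"
  proof -
    have "e (int N) = exp (\<i> * of_real (of_int (2 * d) * pi))"
      using N by (simp add: e_def field_simps)
    then show ?thesis by (simp add: exp_eq_1)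
  qed
  have one_iff: "e 1 = 1 \<longleftrightarrow> int N dvd d"
  proof
    assume "e 1 = 1"
    then obtain n :: int where "2 * pi * of_int d / real N = of_int (2 * n) * pi"
      by (auto simp: e_def exp_eq_1)
    then have "of_int d = of_int n * real N" using N by (simp add: field_simps)
    then have "d = n * int N" by (metis of_int_eq_iff of_int_mult of_int_of_nat_eq)
    then show "int N dvd d" by simp
  next
    assume "int N dvd d"
    then obtain c where c: "d = int N * c" by blast
    have "e 1 = exp (\<i> * of_real (of_int (2 * c) * pi))"
      using N by (simp add: e_def c field_simps)
    then show "e 1 = 1" by (simp add: exp_eq_1)
  qed
  show ?thesis
  proof (cases "int N dvd d")
    case True
    have "e n = 1" for n
    proof -
      obtain c where c: "d = int N * c" using True by blast
      have "e n = exp (\<i> * of_real (of_int (2 * (c * n)) * pi))"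
        using N by (simp add: e_def c field_simps)
      then show "e n = 1" by (simp only: exp_eq_1) (intro conjI exI [of _ "c * n"]; simp)
    qed
    then show ?thesis using True S by (simp add: N_def window_def)
  next
    case False
    have "e 1 * (\<Sum>n\<in>window K. e n) = (\<Sum>n\<in>window K. e (n + 1))"
      by (simp add: sum_distrib_left e_add mult.commute)
    also have "\<dots> = (\<Sum>n\<in>{- int K + 1..int K + 1}. e n)"
      by (rule sum.reindex_bij_witness [of _ "\<lambda>n. n - 1" "\<lambda>n. n + 1"]) (auto simp: window_def)
    also have "\<dots> = (\<Sum>n\<in>{- int K + 1..int K}. e n) + e (int K + 1)"
    proof -
      have "{- int K + 1..int K + 1} = insert (int K + 1) {- int K + 1..int K}" by auto
      then show ?thesis by (simp add: add.commute)
    qed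
    also have "e (int K + 1) = e (- int K)"
      using e_add [of "- int K" "int N"] e_N by (simp add: N_def algebra_simps)
    also have "(\<Sum>n\<in>{- int K + 1..int K}. e n) + e (- int K) = (\<Sum>n\<in>window K. e n)"
    proof -
      have "window K = insert (- int K) {- int K + 1..int K}" by (auto simp: window_def)
      then show ?thesis by (simp add: add.commute)
    qed
    finally have "(\<Sum>n\<in>window K. e n) = 0" using one_iff False by simp
    then show ?thesis using False S by (simp add: N_def)
  qed
qed

lemma idft_dft:
  assumes "cyclic (2 * K + 1) a"
  shows "idft K (dft K a) n = a n"
proof -
  define N where "N = 2 * K + 1"
  define r where "r = (n + int K) mod int N - int K"
  have a_mult: "a (m + int N * int c) = a m" for m c
  proof (induction c)
    case (Suc c)
    have "m + int N * int (Suc c) = (m + int N * int c) + int N" by (simp add: algebra_simps)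
    then show ?case using Suc assms unfolding cyclic_def N_def by metis
  qed simp
  have a_cong: "a m = a m'" if dv: "int N dvd m - m'" for m m'
  proof -
    obtain c where c: "m - m' = int N * c" using dv by blast
    show ?thesis
    proof (cases "c \<ge> 0")
      case True
      then show ?thesis using a_mult [of m' "nat c"] c by (simp add: algebra_simps)
    next
      case False
      then show ?thesis using a_mult [of m "nat (- c)"] c by (simp add: algebra_simps)
    qed
  qed
  have N: "int N = 2 * int K + 1" by (simp add: N_def)
  have "(n + int K) mod int N < int N" "(n + int K) mod int N \<ge> 0"
    using pos_mod_bound [of "int N" "n + int K"] pos_mod_sign [of "int N" "n + int K"] N by linarith+
  then have r: "r \<in> window K" unfolding r_def window_def atLeastAtMost_iff using N by linarith
  have "n - r = n + int K - (n + int K) mod int N" by (simp add: r_def)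
  then have rn: "int N dvd n - r" by (simp add: minus_mod_eq_mult_div)
  have only: "int N dvd n - k \<longleftrightarrow> k = r" if k: "k \<in> window K" for k
  proof
    assume "int N dvd n - k"
    then have "int N dvd r - k" using rn dvd_diff [of "int N" "n - k" "n - r"] by simp
    moreover have "\<bar>r - k\<bar> < int N" using k r by (auto simp: window_def N_def)
    ultimately show "k = r" by (metis dvd_imp_le_int abs_of_nat eq_iff_diff_eq_0 not_less)
  qed (use rn in simp)
  have "idft K (dft K a) n * of_nat N
      = (\<Sum>m\<in>window K. \<Sum>k\<in>window K. a k *
          exp (\<i> * of_real (2 * pi * of_int (n - k) * of_int m / real N)))"
    unfolding idft_def dft_def N_def sum_distrib_right
    by (simp add: sum_distrib_right mult.assoc exp_add [symmetric] diff_divide_distrib algebra_simps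
             del: of_nat_Suc of_nat_add of_nat_mult)
  also have "\<dots> = (\<Sum>k\<in>window K. a k *
      (\<Sum>m\<in>window K. exp (\<i> * of_real (2 * pi * of_int (n - k) * of_int m / real N))))"
    by (subst sum.swap) (simp add: sum_distrib_left)
  also have "\<dots> = (\<Sum>k\<in>window K. if k = r then a k * of_nat N else 0)"
    using only unfolding N_def window_sum_roots_of_unity by (intro sum.cong) auto
  also have "\<dots> = a r * of_nat N" using r by (simp add: window_def)
  finally have "idft K (dft K a) n = a r" by (simp add: N_def del: of_nat_Suc of_nat_add of_nat_mult)
  also have "a r = a n" using a_cong [OF rn] by simp
  finally show ?thesis .
qed

end

theory Submission
  imports Defs
begin

text \<open>
  Write \<open>L x n = (A + 2 B) x n - 2 (\<Sum>k. \<beta> k * x (n + k))\<close> and \<open>c n = \<Sum>k. \<alpha> k * y (n + k)\<close>. For symmetric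
  \<open>\<beta>\<close> one has \<open>G (x + h) y = G x y + 2 \<langle>h, L x - c\<rangle> + G h 0\<close>, and \<open>G h 0 \<ge> A * \<parallel>h\<parallel>\<^sup>2\<close>, so a solution
  of \<open>L x = c\<close> is the unique minimizer. The characters of \<open>\<int>/N\<int>\<close> are eigenvectors of \<open>L\<close>, with
  eigenvalues \<open>A * dft v\<close>, whose real part is at least \<open>A\<close>; hence the Fourier formula solves \<open>L x = c\<close>
  over the complex numbers. Its imaginary part lies in the kernel of \<open>L\<close>, which is trivial.
\<close>

text \<open>Half the gradient of \<open>G\<close>, apart from the data term. The value type is any
  real vector space so that one operator acts on real sequences and on the complex Fourier formula.
  The parameter \<open>A\<close> is free: at \<open>A = 0\<close> only the \<beta>-part
  remains.\<close>

definition normal_op :: "nat \<Rightarrow> real \<Rightarrow> (int \<Rightarrow> real) \<Rightarrow> (int \<Rightarrow> 'a::real_vector) \<Rightarrow> int \<Rightarrow> 'a" where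
  "normal_op K A \<beta> x n =
     (A + 2 * (\<Sum>k\<in>window K. \<beta> k)) *\<^sub>R x n - 2 *\<^sub>R (\<Sum>k\<in>window K. \<beta> k *\<^sub>R x (n + k))"

section \<open>Sums over the window and over one period\<close>

lemma finite_window [simp]: "finite (window K)"
  by (simp add: window_def)

lemma zero_in_window [simp]: "0 \<in> window K"
  by (simp add: window_def)

lemma uminus_in_window [simp]: "- k \<in> window K \<longleftrightarrow> k \<in> window K"
  by (auto simp: window_def)

lemma sum_window_uminus: "(\<Sum>k\<in>window K. f (- k)) = (\<Sum>k\<in>window K. f k)"
  by (rule sum.reindex_bij_witness [of _ uminus uminus]) auto

lemma cyclic_shift_sum:
  fixes f :: "int \<Rightarrow> 'a::ab_group_add"
  assumes "cyclic N f"
  shows "(\<Sum>n\<in>{1..int N}. f (n + k)) = (\<Sum>n\<in>{1..int N}. f n)"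
proof -
  have step: "(\<Sum>n\<in>{1..int N}. f (n + (k + 1))) = (\<Sum>n\<in>{1..int N}. f (n + k))" for k
  proof -
    have "(\<Sum>n\<in>{1..int N}. f (n + (k + 1))) = (\<Sum>n\<in>{2..int N + 1}. f (n + k))"
      by (rule sum.reindex_bij_witness [of _ "\<lambda>n. n - 1" "\<lambda>n. n + 1"]) (auto simp: algebra_simps)
    \<comment> \<open>Removing either end of \<open>{1..int N + 1}\<close> gives the two sums to be
      compared; the removed terms lie a full period apart.\<close>
    moreover have "{1..int N + 1} = insert 1 {2..int N + 1}"
      by auto
    moreover have "{1..int N + 1} = insert (int N + 1) {1..int N}"
      by auto
    ultimately have "f (1 + k) + (\<Sum>n\<in>{1..int N}. f (n + (k + 1)))
        = f (int N + 1 + k) + (\<Sum>n\<in>{1..int N}. f (n + k))"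
      by (metis (no_types, lifting) atLeastAtMost_iff finite_atLeastAtMost_int sum.insert
          zle_add1_eq_le less_irrefl one_add_one add_le_same_cancel1 not_one_le_zero)
    moreover have "f (int N + 1 + k) = f (1 + k)"
      using assms unfolding cyclic_def by (metis add.commute add.left_commute)
    ultimately show ?thesis by simp
  qed
  show ?thesis
  proof (induction k rule: int_induct [where k = 0])
    case (step2 i)
    then show ?case using step [of "i - 1"] by simp
  qed (use step in simp_all)
qed

lemma cyclic_eq_zeroI:
  assumes h: "cyclic N h" and N: "N > 0" and zero: "\<And>n. n \<in> {1..int N} \<Longrightarrow> h n = 0"
  shows "h n = 0"
proof -
  have "h (m + i * int N) = h m" for m i
  proof (induction i rule: int_induct [where k = 0])
    case (step1 i)
    have "h (m + (i + 1) * int N) = h (m + i * int N + int N)"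
      by (simp add: algebra_simps)
    then show ?case using step1 h by (simp add: cyclic_def)
  next
    case (step2 i)
    have "h (m + i * int N) = h (m + (i - 1) * int N + int N)"
      by (simp add: algebra_simps)
    then show ?case using step2 h by (simp add: cyclic_def)
  qed simp
  \<comment> \<open>Subtracting 1 before \<open>mod\<close> and adding it back puts the
    representative in \<open>{1..int N}\<close> instead of \<open>{0..int N - 1}\<close>.\<close>
  from this [of "(n - 1) mod int N + 1" "(n - 1) div int N"]
  have "h n = h ((n - 1) mod int N + 1)"
    by (simp add: algebra_simps)
  also have "\<dots> = 0"
  proof (rule zero)
    have "(n - 1) mod int N < int N" and "(n - 1) mod int N \<ge> 0"
      using N by simp_all
    then show "(n - 1) mod int N + 1 \<in> {1..int N}"
      unfolding atLeastAtMost_iff by linarith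
  qed
  finally show ?thesis .
qed

section \<open>The quadratic form, its expansion and uniqueness of the minimizer\<close>

lemma G_at_zero_nonneg:
  assumes "\<And>k. k \<in> window K \<Longrightarrow> \<alpha> k \<ge> 0" and "\<And>k. k \<in> window K \<Longrightarrow> \<beta> k \<ge> 0"
  shows "G K h (\<lambda>_. 0) \<alpha> \<beta> \<ge> 0"
  unfolding G_def by (intro add_nonneg_nonneg sum_nonneg mult_nonneg_nonneg assms) auto

text \<open>With zero data the \<alpha>-part is exactly \<open>A\<close> times the sum of squares of
  \<open>h\<close> over a period, and the \<beta>-part is nonnegative. Hence \<open>h\<close>
  vanishes on one period, and then everywhere by periodicity.\<close>

lemma G_at_zero_definite:
  assumes h: "cyclic (2 * K + 1) h"
    and \<beta>: "\<And>k. k \<in> window K \<Longrightarrow> \<beta> k \<ge> 0"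
    and A: "(\<Sum>k\<in>window K. \<alpha> k) > 0"
    and le: "G K h (\<lambda>_. 0) \<alpha> \<beta> \<le> 0"
  shows "h n = 0"
proof -
  let ?A = "\<Sum>k\<in>window K. \<alpha> k"
  have "?A * (\<Sum>n\<in>{1..int (2 * K + 1)}. (h n)\<^sup>2) \<le> G K h (\<lambda>_. 0) \<alpha> \<beta>"
  proof -
    have "?A * (\<Sum>n\<in>{1..int (2 * K + 1)}. (h n)\<^sup>2)
        = (\<Sum>n\<in>{1..int (2 * K + 1)}. \<Sum>k\<in>window K. \<alpha> k * (0 - h n)\<^sup>2)"
      by (simp add: sum_distrib_left sum_distrib_right del: of_nat_Suc of_nat_add of_nat_mult)
    moreover have "(\<Sum>n\<in>{1..int (2 * K + 1)}. \<Sum>k\<in>window K. \<beta> k * (h (n + k) - h n)\<^sup>2) \<ge> 0"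
      by (intro sum_nonneg mult_nonneg_nonneg \<beta>) auto
    ultimately show ?thesis unfolding G_def by linarith
  qed
  then have "?A * (\<Sum>n\<in>{1..int (2 * K + 1)}. (h n)\<^sup>2) \<le> 0"
    using le by linarith
  then have "(\<Sum>n\<in>{1..int (2 * K + 1)}. (h n)\<^sup>2) \<le> 0"
    using A by (simp add: mult_le_0_iff)
  then have "(\<Sum>n\<in>{1..int (2 * K + 1)}. (h n)\<^sup>2) = 0"
    by (intro antisym sum_nonneg) auto
  then have "h n = 0" if "n \<in> {1..int (2 * K + 1)}" for n
    using that by (subst (asm) sum_nonneg_eq_0_iff) auto
  then show ?thesis by (rule cyclic_eq_zeroI [OF h, rotated]) auto
qed

text \<open>Discrete Green identity on the cyclic group: translation invariance moves all
  differences from \<open>h\<close> onto \<open>x\<close>. It turns the cross term of the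
  \<beta>-part into a linear form in \<open>h\<close>.\<close>

lemma sum_by_parts:
  fixes x h \<beta> :: "int \<Rightarrow> real"
  assumes x: "cyclic (2 * K + 1) x" and h: "cyclic (2 * K + 1) h"
    and \<beta>: "\<And>k. k \<in> window K \<Longrightarrow> \<beta> (- k) = \<beta> k"
  shows "(\<Sum>n\<in>{1..int (2 * K + 1)}. \<Sum>k\<in>window K. \<beta> k * ((x (n + k) - x n) * (h (n + k) - h n)))
       = (\<Sum>n\<in>{1..int (2 * K + 1)}. h n * normal_op K 0 \<beta> x n)"
proof -
  let ?I = "{1..int (2 * K + 1)}"
  have shift: "(\<Sum>n\<in>?I. f (n + k)) = (\<Sum>n\<in>?I. f n)" if "cyclic (2 * K + 1) f" for f :: "int \<Rightarrow> real" and k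
    using cyclic_shift_sum [OF that] .
  have xh: "(\<Sum>n\<in>?I. x (n + k) * h (n + k)) = (\<Sum>n\<in>?I. x n * h n)" for k
    using x h by (intro shift [where f = "\<lambda>n. x n * h n"]) (simp add: cyclic_def)
  have shift_back: "(\<Sum>n\<in>?I. x n * h (n + k)) = (\<Sum>n\<in>?I. h n * x (n + - k))" for k
  proof -
    \<comment> \<open>The shift of this function by \<open>k\<close> is
      \<open>x n * h (n + k)\<close>.\<close>
    have "cyclic (2 * K + 1) (\<lambda>n. x (n - k) * h n)"
      using x h unfolding cyclic_def by (metis add_diff_eq diff_add_eq)
    from shift [OF this, of k] show ?thesis by (simp add: mult.commute)
  qed
  have "(\<Sum>n\<in>?I. \<Sum>k\<in>window K. \<beta> k * ((x (n + k) - x n) * (h (n + k) - h n)))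
      = (\<Sum>k\<in>window K. \<beta> k * (\<Sum>n\<in>?I. (x (n + k) - x n) * (h (n + k) - h n)))"
    by (subst sum.swap) (simp add: sum_distrib_left)
  also have "\<dots> = (\<Sum>k\<in>window K. \<beta> k * (2 * (\<Sum>n\<in>?I. x n * h n)
      - (\<Sum>n\<in>?I. h n * x (n + k)) - (\<Sum>n\<in>?I. h n * x (n + - k))))"
  proof (intro sum.cong refl)
    fix k
    have "(\<Sum>n\<in>?I. (x (n + k) - x n) * (h (n + k) - h n))
      = (\<Sum>n\<in>?I. x (n + k) * h (n + k)) + (\<Sum>n\<in>?I. x n * h n)
        - (\<Sum>n\<in>?I. h n * x (n + k)) - (\<Sum>n\<in>?I. x n * h (n + k))"
      unfolding sum.distrib [symmetric] sum_subtractf [symmetric]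
      by (intro sum.cong refl) (simp add: algebra_simps)
    then show "\<beta> k * (\<Sum>n\<in>?I. (x (n + k) - x n) * (h (n + k) - h n))
      = \<beta> k * (2 * (\<Sum>n\<in>?I. x n * h n) - (\<Sum>n\<in>?I. h n * x (n + k)) - (\<Sum>n\<in>?I. h n * x (n + - k)))"
      unfolding xh shift_back by simp
  qed
  also have "\<dots> = 2 * (\<Sum>k\<in>window K. \<beta> k) * (\<Sum>n\<in>?I. x n * h n)
      - (\<Sum>k\<in>window K. \<beta> k * (\<Sum>n\<in>?I. h n * x (n + k)))
      - (\<Sum>k\<in>window K. \<beta> k * (\<Sum>n\<in>?I. h n * x (n + - k)))"
    by (simp only: right_diff_distrib sum_subtractf sum_distrib_right [symmetric])
  \<comment> \<open>Symmetry of \<beta> makes the correlations at \<open>k\<close> and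
    \<open>- k\<close> contribute equally, which is the source of the factor 2 in
    \<open>normal_op\<close>.\<close>
  also have "(\<Sum>k\<in>window K. \<beta> k * (\<Sum>n\<in>?I. h n * x (n + - k)))
      = (\<Sum>k\<in>window K. \<beta> (- k) * (\<Sum>n\<in>?I. h n * x (n + - k)))"
    by (intro sum.cong refl) (simp add: \<beta>)
  also have "\<dots> = (\<Sum>k\<in>window K. \<beta> k * (\<Sum>n\<in>?I. h n * x (n + k)))"
    by (rule sum_window_uminus)
  also have "\<dots> = (\<Sum>n\<in>?I. h n * (\<Sum>k\<in>window K. \<beta> k * x (n + k)))"
    unfolding sum_distrib_left by (subst sum.swap) (simp only: mult_ac)
  also have "2 * (\<Sum>k\<in>window K. \<beta> k) * (\<Sum>n\<in>?I. x n * h n)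
      = (\<Sum>n\<in>?I. h n * (2 * (\<Sum>k\<in>window K. \<beta> k) * x n))"
    unfolding sum_distrib_left [of "2 * _"] by (simp only: mult_ac)
  also have "(\<Sum>n\<in>?I. h n * (2 * (\<Sum>k\<in>window K. \<beta> k) * x n))
      - (\<Sum>n\<in>?I. h n * (\<Sum>k\<in>window K. \<beta> k * x (n + k)))
      - (\<Sum>n\<in>?I. h n * (\<Sum>k\<in>window K. \<beta> k * x (n + k)))
      = (\<Sum>n\<in>?I. h n * normal_op K 0 \<beta> x n)"
    unfolding sum_subtractf [symmetric]
    by (intro sum.cong refl) (simp add: normal_op_def algebra_simps)
  finally show ?thesis .
qed

text \<open>\<open>G\<close> is quadratic in \<open>x\<close>, so its Taylor expansion is exact and
  the second-order term is the objective with zero data. The \<alpha>-part expands pointwise; the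
  cross term of the \<beta>-part is handled by \<open>sum_by_parts\<close>.\<close>

lemma G_expansion:
  assumes x: "cyclic (2 * K + 1) x" and h: "cyclic (2 * K + 1) h"
    and \<beta>: "\<And>k. k \<in> window K \<Longrightarrow> \<beta> (- k) = \<beta> k"
  shows "G K (\<lambda>n. x n + h n) y \<alpha> \<beta> = G K x y \<alpha> \<beta>
    + 2 * (\<Sum>n\<in>{1..int (2 * K + 1)}. h n *
        (normal_op K (\<Sum>k\<in>window K. \<alpha> k) \<beta> x n - (\<Sum>k\<in>window K. \<alpha> k * y (n + k))))
    + G K h (\<lambda>_. 0) \<alpha> \<beta>"
proof -
  let ?I = "{1..int (2 * K + 1)}" and ?A = "\<Sum>k\<in>window K. \<alpha> k"
  have "(\<Sum>n\<in>?I. \<Sum>k\<in>window K. \<alpha> k * (y (n + k) - (x n + h n))\<^sup>2)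
      = (\<Sum>n\<in>?I. \<Sum>k\<in>window K. \<alpha> k * (y (n + k) - x n)\<^sup>2)
      + 2 * (\<Sum>n\<in>?I. h n * (?A * x n - (\<Sum>k\<in>window K. \<alpha> k * y (n + k))))
      + (\<Sum>n\<in>?I. \<Sum>k\<in>window K. \<alpha> k * (0 - h n)\<^sup>2)"
    unfolding sum_distrib_left sum_distrib_right sum_subtractf [symmetric] sum.distrib [symmetric]
    by (intro sum.cong refl) (simp add: power2_eq_square algebra_simps)
  moreover have "(\<Sum>n\<in>?I. \<Sum>k\<in>window K. \<beta> k * ((x (n + k) + h (n + k)) - (x n + h n))\<^sup>2)
      = (\<Sum>n\<in>?I. \<Sum>k\<in>window K. \<beta> k * (x (n + k) - x n)\<^sup>2)
      + 2 * (\<Sum>n\<in>?I. \<Sum>k\<in>window K. \<beta> k * ((x (n + k) - x n) * (h (n + k) - h n)))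
      + (\<Sum>n\<in>?I. \<Sum>k\<in>window K. \<beta> k * (h (n + k) - h n)\<^sup>2)"
    unfolding sum_distrib_left sum.distrib [symmetric]
    by (intro sum.cong refl) (simp add: power2_eq_square algebra_simps)
  \<comment> \<open>The gradient splits into the \<alpha>-contribution and the operator with
    \<open>A = 0\<close>, matching the two preceding expansions.\<close>
  moreover have "(\<Sum>n\<in>?I. h n * (normal_op K ?A \<beta> x n - (\<Sum>k\<in>window K. \<alpha> k * y (n + k))))
      = (\<Sum>n\<in>?I. h n * (?A * x n - (\<Sum>k\<in>window K. \<alpha> k * y (n + k))))
      + (\<Sum>n\<in>?I. h n * normal_op K 0 \<beta> x n)"
    unfolding sum.distrib [symmetric]
    by (intro sum.cong refl) (simp add: normal_op_def algebra_simps)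
  ultimately show ?thesis
    using sum_by_parts [OF x h, of \<beta>, OF \<beta>] unfolding G_def by linarith
qed

text \<open>At a solution \<open>x\<close> of the normal equation the linear term of
  \<open>G_expansion\<close> vanishes, so \<open>G\<close> at \<open>z\<close> exceeds
  \<open>G\<close> at \<open>x\<close> by the definite form evaluated at
  \<open>z - x\<close>.\<close>

lemma arg_min_iff_normal_op:
  assumes y: "cyclic (2 * K + 1) y"
    and \<alpha>: "\<And>k. k \<in> window K \<Longrightarrow> \<alpha> k \<ge> 0"
    and \<beta>: "\<And>k. k \<in> window K \<Longrightarrow> \<beta> k \<ge> 0"
    and A: "(\<Sum>k\<in>window K. \<alpha> k) > 0"
    and sym: "\<And>k. k \<in> window K \<Longrightarrow> \<beta> (- k) = \<beta> k"
    and x: "cyclic (2 * K + 1) x"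
    and eq: "\<And>n. normal_op K (\<Sum>k\<in>window K. \<alpha> k) \<beta> x n = (\<Sum>k\<in>window K. \<alpha> k * y (n + k))"
  shows "is_arg_min (\<lambda>x. G K x y \<alpha> \<beta>) (cyclic (2 * K + 1)) z \<longleftrightarrow> z = x"
proof -
  have diff: "cyclic (2 * K + 1) (\<lambda>n. z n - x n)" if "cyclic (2 * K + 1) z" for z
    using that x by (simp add: cyclic_def)
  have expand: "G K z y \<alpha> \<beta> = G K x y \<alpha> \<beta> + G K (\<lambda>n. z n - x n) (\<lambda>_. 0) \<alpha> \<beta>"
    if "cyclic (2 * K + 1) z" for z
    using G_expansion [where \<alpha> = \<alpha> and \<beta> = \<beta> and y = y, OF x diff [OF that] sym] by (simp add: eq)
  show ?thesis
  proof
    assume z: "is_arg_min (\<lambda>x. G K x y \<alpha> \<beta>) (cyclic (2 * K + 1)) z"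
    then have cz: "cyclic (2 * K + 1) z" and "G K z y \<alpha> \<beta> \<le> G K x y \<alpha> \<beta>"
      using x by (auto simp: is_arg_min_linorder)
    then have "G K (\<lambda>n. z n - x n) (\<lambda>_. 0) \<alpha> \<beta> \<le> 0"
      using expand [OF cz] by linarith
    then have "z n - x n = 0" for n
      using G_at_zero_definite [where \<alpha> = \<alpha> and \<beta> = \<beta>, OF diff [OF cz] \<beta> A] by blast
    then show "z = x" by auto
  next
    have "G K x y \<alpha> \<beta> \<le> G K w y \<alpha> \<beta>" if "cyclic (2 * K + 1) w" for w
      unfolding expand [OF that] using G_at_zero_nonneg [of K \<alpha> \<beta>, OF \<alpha> \<beta>] by simp
    moreover assume "z = x"
    ultimately show "is_arg_min (\<lambda>x. G K x y \<alpha> \<beta>) (cyclic (2 * K + 1)) z"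
      using x by (simp add: is_arg_min_linorder)
  qed
qed

text \<open>With zero data, \<open>x\<close> and the zero sequence both solve the normal equation,
  so both are the unique minimizer. This later removes the imaginary part of the Fourier
  formula.\<close>

lemma normal_op_kernel:
  fixes x :: "int \<Rightarrow> real"
  assumes \<alpha>: "\<And>k. k \<in> window K \<Longrightarrow> \<alpha> k \<ge> 0"
    and \<beta>: "\<And>k. k \<in> window K \<Longrightarrow> \<beta> k \<ge> 0"
    and A: "(\<Sum>k\<in>window K. \<alpha> k) > 0"
    and sym: "\<And>k. k \<in> window K \<Longrightarrow> \<beta> (- k) = \<beta> k"
    and x: "cyclic (2 * K + 1) x"
    and eq: "\<And>n. normal_op K (\<Sum>k\<in>window K. \<alpha> k) \<beta> x n = 0"
  shows "x n = 0"
proof -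
  have zero: "cyclic (2 * K + 1) (\<lambda>_. 0 :: real)" by (simp add: cyclic_def)
  have min: "is_arg_min (\<lambda>x. G K x (\<lambda>_. 0) \<alpha> \<beta>) (cyclic (2 * K + 1)) x \<longleftrightarrow> x = z"
    if "cyclic (2 * K + 1) z" and "\<And>n. normal_op K (\<Sum>k\<in>window K. \<alpha> k) \<beta> z n = 0" for z
    using that by (intro arg_min_iff_normal_op zero \<alpha> \<beta> A sym) simp_all
  have "x = (\<lambda>_. 0)"
    using min [OF x eq] min [OF zero] by (simp add: normal_op_def)
  then show ?thesis by simp
qed

section \<open>Characters of the cyclic group and diagonalization by the Fourier transform\<close>

text \<open>The character of frequency \<open>m\<close> at position \<open>n\<close>; negating
  \<open>n\<close> gives the kernel of \<open>dft\<close>.\<close>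

definition root_char :: "nat \<Rightarrow> int \<Rightarrow> int \<Rightarrow> complex" where
  "root_char K n m = exp (\<i> * of_real (2 * pi * of_int n * of_int m / real (2 * K + 1)))"

lemma root_char_add: "root_char K (n + k) m = root_char K n m * root_char K k m"
  by (simp add: root_char_def exp_add [symmetric] add_divide_distrib algebra_simps)

lemma root_char_cyclic: "root_char K (n + int (2 * K + 1)) m = root_char K n m"
proof -
  \<comment> \<open>An even multiple of \<open>pi\<close> is the form in which
    \<open>exp_eq_1\<close> describes the exponent.\<close>
  have "root_char K (int (2 * K + 1)) m = exp (\<i> * of_real (of_int (2 * m) * pi))"
    by (simp add: root_char_def field_simps del: of_nat_Suc of_nat_add of_nat_mult)
  also have "\<dots> = 1" by (simp add: exp_eq_1)
  finally show ?thesis by (simp add: root_char_add)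
qed

lemma idft_root_char: "idft K b n = (\<Sum>m\<in>window K. b m * root_char K n m) / of_nat (2 * K + 1)"
  by (simp add: idft_def root_char_def)

lemma dft_root_char: "dft K a m = (\<Sum>k\<in>window K. a k * root_char K (- k) m)"
  by (simp add: dft_def root_char_def)

lemma idft_cyclic: "cyclic (2 * K + 1) (idft K b)"
  unfolding cyclic_def idft_root_char root_char_cyclic by simp

text \<open>Multiplication by \<open>A\<close> clears the denominators of \<open>v_weights\<close>;
  for symmetric \<beta> the right-hand side is the eigenvalue of \<open>normal_op\<close> at
  frequency \<open>m\<close>.\<close>

lemma dft_v_weights:
  assumes A: "(\<Sum>k\<in>window K. \<alpha> k) > 0" and \<beta>0: "\<beta> 0 = 0"
  shows "of_real (\<Sum>k\<in>window K. \<alpha> k) * dft K (\<lambda>k. of_real (v_weights K \<alpha> \<beta> k)) m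
    = of_real ((\<Sum>k\<in>window K. \<alpha> k) + 2 * (\<Sum>k\<in>window K. \<beta> k))
      - 2 * (\<Sum>k\<in>window K. of_real (\<beta> k) * root_char K (- k) m)"
proof -
  let ?A = "\<Sum>k\<in>window K. \<alpha> k" and ?B = "\<Sum>k\<in>window K. \<beta> k"
  \<comment> \<open>The uniform formula subtracts \<open>2 * \<beta> k\<close> at
    \<open>k = 0\<close> too, where \<open>v_weights\<close> has no such term;
    \<open>\<beta> 0 = 0\<close> reconciles them.\<close>
  have v: "?A * v_weights K \<alpha> \<beta> k = (if k = 0 then ?A + 2 * ?B else 0) - 2 * \<beta> k" for k
    using A by (simp add: v_weights_def Let_def \<beta>0)
  have "of_real ?A * dft K (\<lambda>k. of_real (v_weights K \<alpha> \<beta> k)) m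
      = (\<Sum>k\<in>window K. of_real (?A * v_weights K \<alpha> \<beta> k) * root_char K (- k) m)"
    by (simp add: dft_root_char sum_distrib_left mult.assoc)
  also have "\<dots> = (\<Sum>k\<in>window K. (if k = 0 then of_real (?A + 2 * ?B) else 0)
      - 2 * (of_real (\<beta> k) * root_char K (- k) m))"
    unfolding v by (intro sum.cong refl) (auto simp: root_char_def algebra_simps)
  finally show ?thesis
    by (simp add: sum_subtractf sum_distrib_left)
qed

text \<open>Characters have modulus 1 and \<beta> is nonnegative, so the subtracted sum has real
  part at most \<open>2 * B\<close>, strictly below \<open>A + 2 * B\<close>. This makes the
  division in the Fourier formula genuine, since \<open>x / 0 = 0\<close>.\<close>

lemma dft_v_weights_nonzero:
  assumes A: "(\<Sum>k\<in>window K. \<alpha> k) > 0" and \<beta>0: "\<beta> 0 = 0"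
    and \<beta>: "\<And>k. k \<in> window K \<Longrightarrow> \<beta> k \<ge> 0"
  shows "dft K (\<lambda>k. of_real (v_weights K \<alpha> \<beta> k)) m \<noteq> 0"
proof
  assume "dft K (\<lambda>k. of_real (v_weights K \<alpha> \<beta> k)) m = 0"
  then have "Re (2 * (\<Sum>k\<in>window K. of_real (\<beta> k) * root_char K (- k) m))
      = Re (of_real ((\<Sum>k\<in>window K. \<alpha> k) + 2 * (\<Sum>k\<in>window K. \<beta> k)))"
    using dft_v_weights [where \<alpha> = \<alpha> and \<beta> = \<beta>, OF A \<beta>0, of m] by simp
  moreover have "(\<Sum>k\<in>window K. \<beta> k * Re (root_char K (- k) m)) \<le> (\<Sum>k\<in>window K. \<beta> k * 1)"
  proof (intro sum_mono mult_left_mono \<beta>)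
    fix k
    show "Re (root_char K (- k) m) \<le> 1"
      unfolding root_char_def by (rule order_trans [OF complex_Re_le_cmod]) simp
  qed
  ultimately show False using A by simp
qed

text \<open>Shifting the position by \<open>k\<close> multiplies the component of frequency
  \<open>m\<close> by \<open>root_char K k m\<close>, so the operator acts on each frequency as a
  scalar.\<close>

lemma normal_op_idft:
  assumes A: "(\<Sum>k\<in>window K. \<alpha> k) > 0" and \<beta>0: "\<beta> 0 = 0"
    and sym: "\<And>k. k \<in> window K \<Longrightarrow> \<beta> (- k) = \<beta> k"
  shows "normal_op K (\<Sum>k\<in>window K. \<alpha> k) \<beta> (idft K b) n
    = of_real (\<Sum>k\<in>window K. \<alpha> k) * idft K (\<lambda>m. b m * dft K (\<lambda>k. of_real (v_weights K \<alpha> \<beta> k)) m) n"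
proof -
  let ?A = "\<Sum>k\<in>window K. \<alpha> k" and ?B = "\<Sum>k\<in>window K. \<beta> k"
  let ?N = "of_nat (2 * K + 1) :: complex"
  \<comment> \<open>The operator produces characters at \<open>k\<close>, the transform of
    \<open>v_weights\<close> at \<open>- k\<close>; symmetry of \<beta> identifies the two
    sums.\<close>
  have refl_sum: "(\<Sum>k\<in>window K. of_real (\<beta> k) * root_char K (- k) m)
      = (\<Sum>k\<in>window K. of_real (\<beta> k) * root_char K k m)" for m
    by (subst sum_window_uminus [symmetric]) (simp add: sym)
  have "of_real ?A * idft K (\<lambda>m. b m * dft K (\<lambda>k. of_real (v_weights K \<alpha> \<beta> k)) m) n
      = (\<Sum>m\<in>window K. b m * root_char K n m
          * (of_real ?A * dft K (\<lambda>k. of_real (v_weights K \<alpha> \<beta> k)) m)) / ?N"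
    by (simp add: idft_root_char sum_distrib_left mult_ac del: of_nat_Suc of_nat_add of_nat_mult)
  also have "\<dots> = (\<Sum>m\<in>window K. b m * root_char K n m
          * (of_real (?A + 2 * ?B) - 2 * (\<Sum>k\<in>window K. of_real (\<beta> k) * root_char K k m))) / ?N"
    unfolding dft_v_weights [where \<alpha> = \<alpha> and \<beta> = \<beta>, OF A \<beta>0] refl_sum ..
  also have "\<dots> = of_real (?A + 2 * ?B) * ((\<Sum>m\<in>window K. b m * root_char K n m) / ?N)
      - 2 * ((\<Sum>m\<in>window K. \<Sum>k\<in>window K. of_real (\<beta> k) * (b m * root_char K (n + k) m)) / ?N)"
    unfolding root_char_add right_diff_distrib sum_subtractf diff_divide_distrib
      times_divide_eq_right sum_distrib_left
    by (simp only: mult_ac)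
  also have "(\<Sum>m\<in>window K. \<Sum>k\<in>window K. of_real (\<beta> k) * (b m * root_char K (n + k) m)) / ?N
      = (\<Sum>k\<in>window K. of_real (\<beta> k) * idft K b (n + k))"
    unfolding idft_root_char
    by (subst sum.swap) (simp only: sum_distrib_left sum_divide_distrib times_divide_eq_right)
  finally show ?thesis
    by (simp add: normal_op_def scaleR_conv_of_real idft_root_char)
qed

text \<open>The reflection of \<open>\<alpha>\<close> turns the convolution into the correlation with \<open>y (n + k)\<close>.\<close>
lemma idft_dft_reflected_weights:
  assumes y: "cyclic (2 * K + 1) y" and A: "(\<Sum>k\<in>window K. \<alpha> k) > 0"
  shows "of_real (\<Sum>k\<in>window K. \<alpha> k) * idft K (\<lambda>m. dft K (\<lambda>k. of_real (y k)) m
      * dft K (\<lambda>k. of_real (p_weights K (\<lambda>k. \<alpha> (- k)) k)) m) n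
    = of_real (\<Sum>k\<in>window K. \<alpha> k * y (n + k))"
proof -
  let ?A = "\<Sum>k\<in>window K. \<alpha> k" and ?N = "of_nat (2 * K + 1) :: complex"
  let ?Y = "dft K (\<lambda>k. of_real (y k))"
  have p: "?A * p_weights K (\<lambda>k. \<alpha> (- k)) k = \<alpha> (- k)" for k
    using A by (simp add: p_weights_def Let_def sum_window_uminus)
  have dft_p: "of_real ?A * dft K (\<lambda>k. of_real (p_weights K (\<lambda>k. \<alpha> (- k)) k)) m
      = (\<Sum>k\<in>window K. of_real (\<alpha> k) * root_char K k m)" for m
  proof -
    have "of_real ?A * dft K (\<lambda>k. of_real (p_weights K (\<lambda>k. \<alpha> (- k)) k)) m
        = (\<Sum>k\<in>window K. of_real (?A * p_weights K (\<lambda>k. \<alpha> (- k)) k) * root_char K (- k) m)"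
      by (simp add: dft_root_char sum_distrib_left mult.assoc)
    also have "\<dots> = (\<Sum>k\<in>window K. of_real (\<alpha> k) * root_char K k m)"
      unfolding p by (rule sum_window_uminus)
    finally show ?thesis .
  qed
  have "of_real ?A * idft K (\<lambda>m. ?Y m * dft K (\<lambda>k. of_real (p_weights K (\<lambda>k. \<alpha> (- k)) k)) m) n
      = (\<Sum>m\<in>window K. ?Y m * root_char K n m
          * (of_real ?A * dft K (\<lambda>k. of_real (p_weights K (\<lambda>k. \<alpha> (- k)) k)) m)) / ?N"
    by (simp add: idft_root_char sum_distrib_left mult_ac del: of_nat_Suc of_nat_add of_nat_mult)
  also have "\<dots> = (\<Sum>k\<in>window K. of_real (\<alpha> k) * idft K ?Y (n + k))"
    unfolding dft_p idft_root_char root_char_add sum_distrib_left sum_divide_distrib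
      times_divide_eq_right
    by (subst sum.swap) (simp only: mult_ac)
  also have "\<dots> = (\<Sum>k\<in>window K. of_real (\<alpha> k) * of_real (y (n + k)))"
    using y by (subst idft_dft) (simp_all add: cyclic_def)
  finally show ?thesis by simp
qed

text \<open>The eigenvalue cancels the division by the nonvanishing transform of
  \<open>v_weights\<close>, leaving the inverse transform of a product, which is the correlation of
  \<alpha> with \<open>y\<close>.\<close>

lemma normal_op_fourier_solution:
  assumes y: "cyclic (2 * K + 1) y" and A: "(\<Sum>k\<in>window K. \<alpha> k) > 0" and \<beta>0: "\<beta> 0 = 0"
    and \<beta>: "\<And>k. k \<in> window K \<Longrightarrow> \<beta> k \<ge> 0"
    and sym: "\<And>k. k \<in> window K \<Longrightarrow> \<beta> (- k) = \<beta> k"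
  shows "normal_op K (\<Sum>k\<in>window K. \<alpha> k) \<beta> (fourier_solution K y (\<lambda>k. \<alpha> (- k)) \<beta>) n
    = of_real (\<Sum>k\<in>window K. \<alpha> k * y (n + k))"
proof -
  \<comment> \<open>\<alpha> enters \<open>v_weights\<close> only through its total, which
    reflection preserves.\<close>
  have v: "v_weights K (\<lambda>k. \<alpha> (- k)) \<beta> = v_weights K \<alpha> \<beta>"
    by (simp add: fun_eq_iff v_weights_def Let_def sum_window_uminus)
  show ?thesis
    using idft_dft_reflected_weights [OF y A]
    by (simp add: fourier_solution_def v normal_op_idft [where \<alpha> = \<alpha> and \<beta> = \<beta>, OF A \<beta>0 sym]
        dft_v_weights_nonzero [where \<alpha> = \<alpha> and \<beta> = \<beta>, OF A \<beta>0 \<beta>] del: of_real_sum)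
qed

section \<open>Dependence on the weights, and the closed form of the minimizer\<close>

text \<open>Symmetry of \<alpha> is given only on the window, so \<alpha> and its reflection may
  differ as functions; agreement on the window suffices.\<close>

lemma fourier_solution_cong:
  assumes "\<And>k. k \<in> window K \<Longrightarrow> \<alpha> k = \<alpha>' k"
  shows "fourier_solution K y \<alpha> \<beta> = fourier_solution K y \<alpha>' \<beta>"
proof -
  have A: "(\<Sum>i\<in>window K. \<alpha> i) = (\<Sum>i\<in>window K. \<alpha>' i)"
    by (intro sum.cong refl assms)
  have "dft K (\<lambda>k. of_real (p_weights K \<alpha> k)) = dft K (\<lambda>k. of_real (p_weights K \<alpha>' k))"
    unfolding fun_eq_iff dft_def by (intro allI sum.cong refl) (simp add: p_weights_def A assms)
  moreover have "v_weights K \<alpha> \<beta> = v_weights K \<alpha>' \<beta>"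
    by (simp add: fun_eq_iff v_weights_def A)
  ultimately show ?thesis by (simp add: fourier_solution_def)
qed

text \<open>At \<open>k = 0\<close> the difference \<open>x (n + k) - x n\<close> is zero. This lets
  \<beta> be replaced by \<open>\<beta>(0 := 0)\<close> without changing the minimizer.\<close>

lemma G_ignores_center: "G K x y \<alpha> (\<beta>(0 := c)) = G K x y \<alpha> \<beta>"
  unfolding G_def by (intro arg_cong2 [where f = "(+)"] sum.cong refl) simp

theorem theorem1:
  fixes K :: nat and y \<alpha> \<beta> :: "int \<Rightarrow> real"
  assumes y_cyclic: "cyclic (2 * K + 1) y"
    and \<alpha>_nonneg: "\<And>k. k \<in> window K \<Longrightarrow> \<alpha> k \<ge> 0"
    and \<beta>_nonneg: "\<And>k. k \<in> window K \<Longrightarrow> \<beta> k \<ge> 0"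
    and A_pos: "(\<Sum>k\<in>window K. \<alpha> k) > 0"
    and \<beta>_sym: "\<And>k. k \<in> window K \<Longrightarrow> \<beta> (- k) = \<beta> k"
  shows "\<exists>xopt.
      (\<forall>x. is_arg_min (\<lambda>x. G K x y \<alpha> \<beta>) (cyclic (2 * K + 1)) x \<longleftrightarrow> x = xopt)
    \<and> ((\<forall>k\<in>window K. \<alpha> (- k) = \<alpha> k) \<and> \<beta> 0 = 0 \<longrightarrow>
        (\<forall>n. dft K (\<lambda>k. of_real (v_weights K \<alpha> \<beta> k)) n \<noteq> 0)
      \<and> (\<forall>n. complex_of_real (xopt n) = fourier_solution K y \<alpha> \<beta> n))
    \<and> (\<forall>n. dft K (\<lambda>k. of_real (v_weights K \<alpha> (\<beta>(0 := 0)) k)) n \<noteq> 0)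
    \<and> (\<forall>n. complex_of_real (xopt n) = fourier_solution K y (\<lambda>k. \<alpha> (- k)) (\<beta>(0 := 0)) n)"
proof -
  let ?b = "\<beta>(0 := 0)" and ?A = "\<Sum>k\<in>window K. \<alpha> k"
  let ?F = "fourier_solution K y (\<lambda>k. \<alpha> (- k)) ?b"
  \<comment> \<open>The Fourier formula is complex a priori; its real part is the candidate until
    the imaginary part is shown to vanish.\<close>
  define xopt where "xopt = (\<lambda>n. Re (?F n))"
  have b_nonneg: "?b k \<ge> 0" if "k \<in> window K" for k
    using \<beta>_nonneg that by simp
  have b_sym: "?b (- k) = ?b k" if "k \<in> window K" for k
    using \<beta>_sym that by simp
  have F_cyclic: "cyclic (2 * K + 1) ?F"
    unfolding fourier_solution_def by (rule idft_cyclic)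
  note F_eq = normal_op_fourier_solution [where \<beta> = ?b, OF y_cyclic A_pos fun_upd_same b_nonneg b_sym]
  have "normal_op K ?A ?b xopt n = Re (normal_op K ?A ?b ?F n)" for n
    by (simp add: normal_op_def xopt_def)
  then have Re_eq: "normal_op K ?A ?b xopt n = (\<Sum>k\<in>window K. \<alpha> k * y (n + k))" for n
    by (simp add: F_eq)
  \<comment> \<open>The operator has real coefficients, so it commutes with \<open>Im\<close>; the
    data are real, so the imaginary part lies in its kernel.\<close>
  have "normal_op K ?A ?b (\<lambda>n. Im (?F n)) n = Im (normal_op K ?A ?b ?F n)" for n
    by (simp add: normal_op_def)
  then have "normal_op K ?A ?b (\<lambda>n. Im (?F n)) n = 0" for n
    by (simp add: F_eq)
  moreover have "cyclic (2 * K + 1) (\<lambda>n. Im (?F n))"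
    using F_cyclic by (simp add: cyclic_def)
  ultimately have "Im (?F n) = 0" for n
    using normal_op_kernel [of K \<alpha> ?b "\<lambda>n. Im (?F n)", OF \<alpha>_nonneg b_nonneg A_pos b_sym] by blast
  then have real: "complex_of_real (xopt n) = ?F n" for n
    by (simp add: xopt_def complex_eq_iff)
  have "cyclic (2 * K + 1) xopt"
    using F_cyclic by (simp add: cyclic_def xopt_def)
  \<comment> \<open>The minimizer is found for the weights \<open>\<beta>(0 := 0)\<close> and
    carried over to \<beta> because both give the same objective.\<close>
  from arg_min_iff_normal_op [where \<alpha> = \<alpha> and \<beta> = ?b, OF y_cyclic \<alpha>_nonneg b_nonneg A_pos b_sym this Re_eq]
  have min: "is_arg_min (\<lambda>x. G K x y \<alpha> \<beta>) (cyclic (2 * K + 1)) x \<longleftrightarrow> x = xopt" for x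
    by (simp only: G_ignores_center)
  have nz: "dft K (\<lambda>k. of_real (v_weights K \<alpha> ?b k)) n \<noteq> 0" for n
    by (rule dft_v_weights_nonzero [where \<beta> = ?b, OF A_pos fun_upd_same b_nonneg])
  show ?thesis
  proof (intro exI [of _ xopt] conjI impI allI)
    assume "(\<forall>k\<in>window K. \<alpha> (- k) = \<alpha> k) \<and> \<beta> 0 = 0"
    then have b: "?b = \<beta>" and \<alpha>: "\<And>k. k \<in> window K \<Longrightarrow> \<alpha> k = \<alpha> (- k)"
      by (auto simp: fun_eq_iff)
    show "dft K (\<lambda>k. of_real (v_weights K \<alpha> \<beta> k)) n \<noteq> 0" for n
      using nz [of n] unfolding b .
    show "complex_of_real (xopt n) = fourier_solution K y \<alpha> \<beta> n" for n
      using real [of n] fourier_solution_cong [of K \<alpha> "\<lambda>k. \<alpha> (- k)" y \<beta>, OF \<alpha>]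
      unfolding b by simp
  qed (use min real nz in auto)
qed

end
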